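(* For integers $n,k\ge 0$ let $g(n,k)$ denote the number of $k$-faces of the arrangement $I(\mathfrak{gl}_n,V\oplus\bigwedge^2)$. Then, as formal power series, \[ G(s,t)=\sum_{n,k\ge 0} g(n,k)\,s^n t^k=\frac{1-s}{1-2s+s^2-2st+s^2t}. \]
   Context: Identify the diagonal Cartan subalgebra of $\mathfrak{gl}_n$ with $\mathbb{R}^n$ with coordinates $x_1,\dots,x_n$. Let $W=\{x\in\mathbb{R}^n: x_1\ge x_2\ge\cdots\ge x_n\}$ be the closed (dual fundamental) Weyl chamber and $W^0=\{x_1>\cdots>x_n\}$ its interior. For $1\le i\le j\le n$ let $\lambda_{i,j}=x_i+x_j$ and $\lambda_{i,j}^\perp$ its kernel (for $i=j$ this is the hyperplane $x_i=0$). These are the kernels of the weights of $V\oplus\bigwedge^2V$, $V$ the vector representation, and $I(\mathfrak{gl}_n,V\oplus\bigwedge^2)$ is the arrangement of these hyperplanes restricted to $W$. Its chambers are the closures of the connected components of $W^0\setminus\bigcup_{i\le j}\lambda_{i,j}^\perp$ (polyhedral cones); a face is a chamber or the intersection of a chamber with a supporting hyperplane of it; a $k$-face is a face whose linear span has dimension $k$. (For $n=0$ the only face is the origin.) *)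

theory Defs
  imports "HOL-Analysis.Analysis" "HOL-Library.Function_Algebras"
          "HOL-Computational_Algebra.Formal_Power_Series"
begin

text \<open>Model of R^n: functions nat => real vanishing from index n on
  (coordinates x_1..x_n are x 0 .. x (n-1)); the ambient topology on
  nat => real is the product topology, which induces the Euclidean topology
  on this closed subset.\<close>

definition Rn :: "nat \<Rightarrow> (nat \<Rightarrow> real) set" where
  "Rn n = {x. \<forall>i\<ge>n. x i = 0}"

definition Wint :: "nat \<Rightarrow> (nat \<Rightarrow> real) set" where
  "Wint n = {x \<in> Rn n. \<forall>i j. i < j \<and> j < n \<longrightarrow> x i > x j}"

definition lam_ker :: "nat \<Rightarrow> nat \<Rightarrow> nat \<Rightarrow> (nat \<Rightarrow> real) set" where
  "lam_ker n i j = {x \<in> Rn n. x i + x j = 0}"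

definition arr_complement :: "nat \<Rightarrow> (nat \<Rightarrow> real) set" where
  "arr_complement n =
     Wint n - (\<Union>(i, j) \<in> {(i, j). i \<le> j \<and> j < n}. lam_ker n i j)"

definition chambers :: "nat \<Rightarrow> (nat \<Rightarrow> real) set set" where
  "chambers n = {closure (connected_component_set (arr_complement n) x) | x.
                   x \<in> arr_complement n}"

definition hyperplane_n :: "nat \<Rightarrow> (nat \<Rightarrow> real) \<Rightarrow> real \<Rightarrow> (nat \<Rightarrow> real) set" where
  "hyperplane_n n a b = {x \<in> Rn n. (\<Sum>i<n. a i * x i) = b}"

definition supporting_hyperplane ::
  "nat \<Rightarrow> (nat \<Rightarrow> real) set \<Rightarrow> (nat \<Rightarrow> real) set \<Rightarrow> bool" where
  "supporting_hyperplane n C H \<longleftrightarrow>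
     (\<exists>a b. (\<exists>i<n. a i \<noteq> 0) \<and> H = hyperplane_n n a b \<and>
            (\<forall>x\<in>C. (\<Sum>i<n. a i * x i) \<le> b) \<and> C \<inter> H \<noteq> {})"

definition faces :: "nat \<Rightarrow> (nat \<Rightarrow> real) set set" where
  "faces n = {F. \<exists>C \<in> chambers n. F = C \<or>
                   (\<exists>H. supporting_hyperplane n C H \<and> F = C \<inter> H)}"

definition fscale :: "real \<Rightarrow> (nat \<Rightarrow> real) \<Rightarrow> (nat \<Rightarrow> real)" where
  "fscale c x = (\<lambda>i. c * x i)"

definition span_dim :: "(nat \<Rightarrow> real) set \<Rightarrow> nat" where
  "span_dim F = vector_space.dim fscale (module.span fscale F)"

definition g :: "nat \<Rightarrow> nat \<Rightarrow> nat" where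
  "g n k = card {F \<in> faces n. span_dim F = k}"

text \<open>Bivariate generating series: outer variable s, inner variable t.\<close>
definition G :: "int fps fps" where
  "G = Abs_fps (\<lambda>n. Abs_fps (\<lambda>k. int (g n k)))"

end

theory Submission
  imports Defs
begin

text \<open>
  Sorting the coordinates of a generic point of W by decreasing absolute value consumes them from
  the two ends of 0, ..., n - 1: a positive coordinate is taken from the left, a negative one from
  the right. Recording how many of each sign have been taken gives a lattice path, so the chambers
  correspond to the lattice paths with n unit steps, and each chamber is the simplicial cone spanned
  by the vectors (1, ..., 1, 0, ..., 0, -1, ..., -1) attached to the nonzero nodes (a, b) of its
  path, with a entries 1 and b entries -1. Hence the k-faces correspond to the k-element chains, for
  the componentwise order, in the set of (a, b) with 1 \<le> a + b \<le> n. Splitting off the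
  least element of a chain gives G = E + t (E^2 - 1) G with E = 1 / (1 - s).
\<close>

section \<open>Grid nodes, step vectors and the cones they span\<close>

definition grid :: "nat \<Rightarrow> (nat \<times> nat) set" where
  "grid n = {(a, b). 1 \<le> a + b \<and> a + b \<le> n}"

definition grid_chain :: "(nat \<times> nat) set \<Rightarrow> bool" where
  "grid_chain T \<longleftrightarrow> (\<forall>v\<in>T. \<forall>w\<in>T.
     fst v \<le> fst w \<and> snd v \<le> snd w \<or> fst w \<le> fst v \<and> snd w \<le> snd v)"

text \<open>When the coordinate sum of the node is at most n, the block of ones and the block of
  minus ones are disjoint; the lemmas about these vectors assume this bound. A zero second component
  makes the negative block empty.\<close>

definition step_vec :: "nat \<Rightarrow> nat \<times> nat \<Rightarrow> nat \<Rightarrow> real" where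
  "step_vec n v i = (if i < fst v then 1 else if n - snd v \<le> i \<and> i < n then -1 else 0)"

text \<open>The empty set of nodes gives the origin, so the 0-face is covered without a special
  case.\<close>

definition grid_cone :: "nat \<Rightarrow> (nat \<times> nat) set \<Rightarrow> (nat \<Rightarrow> real) set" where
  "grid_cone n T = {\<lambda>i. \<Sum>v\<in>T. c v * step_vec n v i | c. \<forall>v\<in>T. 0 \<le> c v}"

lemma finite_grid: "finite (grid n)"
  by (rule finite_subset[of _ "{..n} \<times> {..n}"]) (auto simp: grid_def)

lemma step_vec_in_Rn: "fst v + snd v \<le> n \<Longrightarrow> step_vec n v \<in> Rn n"
  by (auto simp: Rn_def step_vec_def)

lemma step_vec_antimono:
  "fst v + snd v \<le> n \<Longrightarrow> i < j \<Longrightarrow> j < n \<Longrightarrow> step_vec n v j \<le> step_vec n v i"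
  by (auto simp: step_vec_def)

text \<open>The length of the initial run of ones determines \<open>fst\<close>. Of two vectors with
  equal \<open>fst\<close>, the one with the longer negative block has -1 at the start of that
  block, where the other has 0.\<close>

lemma step_vec_inject:
  assumes "fst v + snd v \<le> n" "fst w + snd w \<le> n" "step_vec n v = step_vec n w"
  shows "v = w"
proof -
  have "fst v = fst w"
    using fun_cong[OF assms(3), of "fst v"] fun_cong[OF assms(3), of "fst w"]
    by (auto simp: step_vec_def split: if_splits)
  moreover have "snd v \<le> snd w"
    if "fst v = fst w" "fst v + snd v \<le> n" "step_vec n v = step_vec n w" for v w
  proof (rule ccontr)
    assume *: "\<not> snd v \<le> snd w"
    then have "\<not> n - snd v < fst v" "n - snd v < n" "\<not> n - snd w \<le> n - snd v"
      using that by linarith+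
    then have "step_vec n v (n - snd v) = -1" "step_vec n w (n - snd v) = 0"
      using that(1) by (simp_all add: step_vec_def)
    then show False using that(3) by simp
  qed
  ultimately show ?thesis
    using assms by (metis order_antisym prod_eq_iff)
qed

text \<open>A discrete intermediate value principle. It finds the step of a path at which a given
  index is taken.\<close>

lemma unit_steps_hit:
  fixes f :: "nat \<Rightarrow> nat"
  assumes "f 0 = 0" "\<And>j. f (Suc j) \<le> Suc (f j)" "m < f n"
  shows "\<exists>j<n. f j = m \<and> f (Suc j) = Suc m"
  using assms(3)
proof (induction n)
  case 0
  then show ?case using assms(1) by simp
next
  case (Suc n)
  show ?case
  proof (cases "m < f n")
    case True
    then show ?thesis using Suc.IH less_Suc_eq by blast
  next
    case False
    then have "f n = m \<and> f (Suc n) = Suc m"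
      using Suc.prems assms(2)[of n] by linarith
    then show ?thesis by blast
  qed
qed

section \<open>Lattice paths, their cells and the slack coordinates\<close>

locale lattice_path =
  fixes n :: nat and p :: "nat \<Rightarrow> nat"
  assumes p_0: "p 0 = 0"
    and p_step: "\<And>j. p (Suc j) = p j \<or> p (Suc j) = Suc (p j)"
begin

text \<open>\<open>p j\<close> counts the left steps, which take positive entries, among the first j
  steps; the remaining \<open>j - p j\<close> are right steps. Paths are infinite, but the cells
  below depend only on the first n steps, so different \<open>p\<close> may describe the same
  cell.\<close>

definition node :: "nat \<Rightarrow> nat \<times> nat" where
  "node k = (p k, k - p k)"

text \<open>The index taken in step j. A left step takes the first remaining index
  \<open>p j\<close>. A right step is preceded by \<open>j - p j\<close> right steps, each of which
  has removed one index from the end \<open>n - 1\<close>.\<close>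

definition pos :: "nat \<Rightarrow> nat" where
  "pos j = (if p (Suc j) = p j then n - 1 - (j - p j) else p j)"

text \<open>On the chamber of the path, coord lists the absolute values of the coordinates in
  decreasing order; slack lists the consecutive differences, which are the coefficients with respect
  to the spanning vectors.\<close>

definition coord :: "nat \<Rightarrow> (nat \<Rightarrow> real) \<Rightarrow> real" where
  "coord j x = (if j < n then if p (Suc j) = p j then - x (pos j) else x (pos j) else 0)"

definition slack :: "nat \<Rightarrow> (nat \<Rightarrow> real) \<Rightarrow> real" where
  "slack k x = coord k x - coord (Suc k) x"

text \<open>Since \<open>coord n x\<close> is 0, the condition for k = n - 1 says that the last
  listed value is positive; the other conditions say that the list is strictly decreasing.\<close>

definition open_cell :: "(nat \<Rightarrow> real) set" where
  "open_cell = {x \<in> Rn n. \<forall>k<n. 0 < slack k x}"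

definition closed_cell :: "(nat \<Rightarrow> real) set" where
  "closed_cell = {x \<in> Rn n. \<forall>k<n. 0 \<le> slack k x}"

lemma p_mono:
  assumes "i \<le> j" shows "p i \<le> p j"
proof -
  have "p k \<le> p (Suc k)" for k using p_step[of k] by linarith
  then show ?thesis using assms by (rule lift_Suc_mono_le)
qed

text \<open>This is monotonicity of the number \<open>j - p j\<close> of right steps, written
  additively to avoid truncated subtraction.\<close>

lemma p_lipschitz: "i \<le> j \<Longrightarrow> p j + i \<le> p i + j"
proof (induction j rule: dec_induct)
  case base
  then show ?case by simp
next
  case (step m)
  then show ?case using p_step[of m] by linarith
qed

lemma p_le: "p j \<le> j"
  using p_lipschitz[of 0 j] p_0 by simp

lemma node_sum: "fst (node k) + snd (node k) = k"
  using p_le[of k] by (simp add: node_def)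

lemma node_inj: "node k = node l \<longleftrightarrow> k = l"
  using node_sum by metis

lemma node_in_grid: "k < n \<Longrightarrow> node (Suc k) \<in> grid n"
  using node_sum[of "Suc k"] by (auto simp: grid_def split: prod.splits)

lemma grid_chain_nodes: "grid_chain (node ` K)"
proof -
  have le: "p i \<le> p j \<and> i - p i \<le> j - p j" if "i \<le> j" for i j
    using p_mono[OF that] p_lipschitz[OF that] p_le[of i] p_le[of j] by linarith
  have "p i \<le> p j \<and> i - p i \<le> j - p j \<or> p j \<le> p i \<and> j - p j \<le> i - p i" for i j
    using le[of i j] le[of j i] nat_le_linear[of i j] by blast
  then show ?thesis unfolding grid_chain_def node_def by auto
qed

lemma pos_less: "j < n \<Longrightarrow> pos j < n"
  using p_le[of j] by (auto simp: pos_def)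

text \<open>The first n steps include \<open>p n\<close> left steps, which take the indices below
  \<open>p n\<close>; the right steps take the others.\<close>

lemma pos_surj:
  assumes "i < n" shows "\<exists>j<n. pos j = i"
proof (cases "i < p n")
  case True
  then obtain j where "j < n" "p j = i" "p (Suc j) = Suc i"
    using unit_steps_hit[of p i n] p_0 p_step by (metis le_refl le_Suc_eq)
  then show ?thesis by (auto simp: pos_def)
next
  case False
  \<comment> \<open>\<open>q\<close> counts right steps. Index i is taken by the right step that
    raises this count from n - 1 - i.\<close>
  define q where "q j = j - p j" for j
  have "n - 1 - i < q n" using False assms unfolding q_def by linarith
  moreover have "q 0 = 0" by (simp add: q_def)
  moreover have "q (Suc j) \<le> Suc (q j)" for j
    using p_step[of j] p_le[of j] unfolding q_def by linarith
  ultimately obtain j where j: "j < n" "q j = n - 1 - i" "q (Suc j) = Suc (n - 1 - i)"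
    using unit_steps_hit[of q "n - 1 - i" n] by blast
  then have "p (Suc j) = p j"
    using p_step[of j] p_le[of j] unfolding q_def by auto
  then have "pos j = i" using j assms unfolding pos_def q_def by auto
  then show ?thesis using j by blast
qed

text \<open>The indices taken in the first k steps are exactly those in the two nonzero blocks of
  the k-th node, and the sign of the block agrees with the kind of step. Monotonicity of both step
  counts decides on which side of a block boundary \<open>pos j\<close> lies.\<close>

lemma coord_step_vec_node:
  assumes "j < n" "k \<le> n"
  shows "coord j (step_vec n (node k)) = (if j < k then 1 else 0)"
proof -
  have a: "p j + q \<le> p q + j" if "q \<le> j" for q using p_lipschitz[OF that] .
  have jn: "p (Suc j) \<le> p n" "p n + Suc j \<le> p (Suc j) + n" "p n \<le> n" "p k \<le> p n"
    "p n + k \<le> p k + n" "p j \<le> j" "p k \<le> k"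
    using p_mono[of "Suc j" n] p_lipschitz[of "Suc j" n] p_mono[of k n] p_lipschitz[of k n] assms p_le
    by auto
  have lt: "p (Suc j) \<le> p k" "p k + Suc j \<le> p (Suc j) + k" if "j < k"
    using that p_mono[of "Suc j" k] p_lipschitz[of "Suc j" k] by auto
  have ge: "p k \<le> p j" "p j + k \<le> p k + j" if "\<not> j < k"
    using that p_mono[of k j] p_lipschitz[of k j] by auto
  show ?thesis
  proof (cases "p (Suc j) = p j")
    case True
    have i: "\<not> n - 1 - (j - p j) < p k" "n - 1 - (j - p j) < n"
      using True jn assms by linarith+
    have "n - (k - p k) \<le> n - 1 - (j - p j) \<longleftrightarrow> j < k"
    proof (cases "j < k")
      case True
      then show ?thesis using lt[OF True] \<open>p (Suc j) = p j\<close> jn assms by linarith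
    next
      case False
      then show ?thesis using ge[OF False] \<open>p (Suc j) = p j\<close> jn assms by linarith
    qed
    then show ?thesis
      using True i assms by (simp add: coord_def step_vec_def node_def pos_def)
  next
    case False
    then have up: "p (Suc j) = Suc (p j)" using p_step[of j] by simp
    have "p j < p k \<longleftrightarrow> j < k"
      using up lt ge by (cases "j < k") auto
    moreover have "\<not> n - (k - p k) \<le> p j"
      using up jn by linarith
    ultimately show ?thesis
      using up assms by (simp add: coord_def step_vec_def node_def pos_def)
  qed
qed

text \<open>Differences of a run of ones followed by zeros: the slacks form the dual basis to the
  step vectors of the nonzero nodes on the path.\<close>

lemma slack_step_vec_node:
  assumes "k < n" "l < n"
  shows "slack k (step_vec n (node (Suc l))) = (if k = l then 1 else 0)"
proof (cases "Suc k < n")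
  case True
  then show ?thesis using assms by (simp add: slack_def coord_step_vec_node)
next
  case False
  then have "coord (Suc k) x = 0" for x by (simp add: coord_def)
  then show ?thesis using assms False by (auto simp: slack_def coord_step_vec_node)
qed

lemma coord_sum: "coord j (\<lambda>i. \<Sum>v\<in>T. c v * f v i) = (\<Sum>v\<in>T. c v * coord j (f v))"
  by (simp add: coord_def sum_negf)

lemma slack_sum: "slack j (\<lambda>i. \<Sum>v\<in>T. c v * f v i) = (\<Sum>v\<in>T. c v * slack j (f v))"
  by (simp add: slack_def coord_sum right_diff_distrib sum_subtractf)

lemma slack_node_sum:
  assumes "k < n" "K \<subseteq> {..<n}"
  shows "slack k (\<lambda>i. \<Sum>l\<in>K. c l * step_vec n (node (Suc l)) i) = (if k \<in> K then c k else 0)"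
proof -
  have "slack k (\<lambda>i. \<Sum>l\<in>K. c l * step_vec n (node (Suc l)) i)
      = (\<Sum>l\<in>K. c l * slack k (step_vec n (node (Suc l))))"
    by (rule slack_sum)
  also have "\<dots> = (\<Sum>l\<in>K. if k = l then c l else 0)"
    using assms by (intro sum.cong) (auto simp: slack_step_vec_node)
  also have "\<dots> = (if k \<in> K then c k else 0)"
    using finite_subset[OF assms(2)] by simp
  finally show ?thesis .
qed

text \<open>The sum telescopes, ending with the default value 0 of \<open>coord n x\<close>.\<close>

lemma coord_eq_sum_slack: "j \<le> n \<Longrightarrow> coord j x = (\<Sum>k=j..<n. slack k x)"
proof (induction j rule: inc_induct)
  case base
  then show ?case by (simp add: coord_def)
next
  case (step m)
  then show ?case by (simp add: sum.atLeast_Suc_lessThan slack_def)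
qed

text \<open>Slacks determine every \<open>coord\<close> by telescoping, and by
  \<open>pos_surj\<close> each entry below n is some \<open>coord\<close> up to sign.\<close>

lemma eq_if_slack_eq:
  assumes "x \<in> Rn n" "y \<in> Rn n" "\<And>k. k < n \<Longrightarrow> slack k x = slack k y"
  shows "x = y"
proof
  fix i
  show "x i = y i"
  proof (cases "i < n")
    case True
    then obtain j where j: "j < n" "pos j = i" using pos_surj by blast
    have "coord j x = coord j y"
      using j assms(3) by (simp add: coord_eq_sum_slack)
    then show ?thesis using j by (simp add: coord_def split: if_splits)
  next
    case False
    then show ?thesis using assms by (simp add: Rn_def)
  qed
qed

lemma node_sum_in_Rn:
  assumes "K \<subseteq> {..<n}"
  shows "(\<lambda>i. \<Sum>l\<in>K. c l * step_vec n (node (Suc l)) i) \<in> Rn n"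
proof -
  have "step_vec n (node (Suc l)) i = 0" if "l \<in> K" "n \<le> i" for l i
    using step_vec_in_Rn[of "node (Suc l)" n] node_sum[of "Suc l"] that assms
    by (auto simp: Rn_def)
  then show ?thesis by (simp add: Rn_def)
qed

lemma slack_expansion:
  assumes "x \<in> Rn n"
  shows "x = (\<lambda>i. \<Sum>k<n. slack k x * step_vec n (node (Suc k)) i)"
  by (rule eq_if_slack_eq[OF assms node_sum_in_Rn]) (simp_all add: slack_node_sum)

text \<open>By duality the coefficients of a combination of step vectors are its slacks, so leaving
  out a node amounts to requiring its slack to vanish.\<close>

lemma grid_cone_nodes:
  assumes "K \<subseteq> {..<n}"
  shows "grid_cone n ((\<lambda>k. node (Suc k)) ` K)
       = {x \<in> closed_cell. \<forall>k<n. k \<notin> K \<longrightarrow> slack k x = 0}"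
proof -
  have inj: "inj_on (\<lambda>k. node (Suc k)) K" by (simp add: inj_on_def node_inj)
  show ?thesis
  proof (intro equalityI subsetI)
    fix x assume "x \<in> grid_cone n ((\<lambda>k. node (Suc k)) ` K)"
    then obtain c where c: "\<forall>k\<in>K. 0 \<le> c (node (Suc k))"
      "x = (\<lambda>i. \<Sum>k\<in>K. c (node (Suc k)) * step_vec n (node (Suc k)) i)"
      unfolding grid_cone_def by (auto simp: sum.reindex[OF inj])
    then show "x \<in> {x \<in> closed_cell. \<forall>k<n. k \<notin> K \<longrightarrow> slack k x = 0}"
      using assms by (auto simp: closed_cell_def node_sum_in_Rn slack_node_sum)
  next
    fix x assume "x \<in> {x \<in> closed_cell. \<forall>k<n. k \<notin> K \<longrightarrow> slack k x = 0}"
    then have x: "x \<in> Rn n" "\<And>k. k < n \<Longrightarrow> 0 \<le> slack k x"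
      "\<And>k. k < n \<Longrightarrow> k \<notin> K \<Longrightarrow> slack k x = 0"
      by (auto simp: closed_cell_def)
    \<comment> \<open>The coefficients have to be a function of the node; its coordinate sum is
      \<open>Suc k\<close>, which gives back the index k.\<close>
    define c where "c v = slack (fst v + snd v - 1) x" for v
    have c: "c (node (Suc k)) = slack k x" for k
      unfolding c_def by (simp add: node_sum)
    have "x = (\<lambda>i. \<Sum>k\<in>K. slack k x * step_vec n (node (Suc k)) i)"
      by (rule eq_if_slack_eq[OF x(1) node_sum_in_Rn[OF assms]])
        (use x assms in \<open>auto simp: slack_node_sum\<close>)
    also have "\<dots> = (\<lambda>i. \<Sum>v\<in>(\<lambda>k. node (Suc k)) ` K. c v * step_vec n v i)"
      by (simp add: sum.reindex[OF inj] c)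
    finally show "x \<in> grid_cone n ((\<lambda>k. node (Suc k)) ` K)"
      unfolding grid_cone_def using x(2) assms c by (intro CollectI exI[of _ c]) auto
  qed
qed

lemma grid_cone_all_nodes: "grid_cone n ((\<lambda>k. node (Suc k)) ` {..<n}) = closed_cell"
  by (subst grid_cone_nodes) auto

section \<open>Open cells as components of the arrangement complement\<close>

lemma coord_less:
  assumes "x \<in> open_cell" "i < j" "j \<le> n"
  shows "coord j x < coord i x"
proof -
  have "coord j x = (\<Sum>k=j..<n. slack k x)" "coord i x = (\<Sum>k=i..<n. slack k x)"
    using assms by (auto intro: coord_eq_sum_slack)
  moreover have "(\<Sum>k=j..<n. slack k x) < (\<Sum>k=i..<n. slack k x)"
    by (rule sum_strict_mono2[of _ _ i])
      (use assms in \<open>auto simp: open_cell_def less_imp_le\<close>)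
  ultimately show ?thesis by simp
qed

lemma abs_at_pos:
  assumes "x \<in> open_cell" "j < n"
  shows "\<bar>x (pos j)\<bar> = coord j x"
proof -
  have "0 < coord j x" using coord_less[OF assms(1), of j n] assms by (simp add: coord_def)
  then show ?thesis using assms by (auto simp: coord_def split: if_splits)
qed

text \<open>The absolute values of the entries are nonzero and pairwise distinct because the
  \<open>coord\<close> list is strictly decreasing down to 0. A nonnegative combination of step
  vectors is weakly decreasing, and distinct absolute values make this strict and keep sums of two
  entries away from 0.\<close>

lemma open_cell_subset: "open_cell \<subseteq> arr_complement n"
proof
  fix x assume x: "x \<in> open_cell"
  then have xR: "x \<in> Rn n" and sl: "\<And>k. k < n \<Longrightarrow> 0 < slack k x"
    by (auto simp: open_cell_def)
  have nz: "x i \<noteq> 0" if i: "i < n" for i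
  proof -
    obtain j where "j < n" "pos j = i" using pos_surj[OF i] by blast
    then show ?thesis
      using coord_less[OF x, of j n] abs_at_pos[OF x, of j] by (simp add: coord_def)
  qed
  have ne: "\<bar>x i\<bar> \<noteq> \<bar>x i'\<bar>" if i: "i < n" "i' < n" "i \<noteq> i'" for i i'
  proof -
    obtain j j' where j: "j < n" "pos j = i" "j' < n" "pos j' = i'"
      using pos_surj i by metis
    then have "j \<noteq> j'" using i by auto
    then show ?thesis
      using coord_less[OF x, of j j'] coord_less[OF x, of j' j] abs_at_pos[OF x, of j]
        abs_at_pos[OF x, of j'] j by (cases "j < j'") auto
  qed
  have "x j \<le> x i" if "i < j" "j < n" for i j
  proof -
    have "(\<Sum>k<n. slack k x * step_vec n (node (Suc k)) j)
        \<le> (\<Sum>k<n. slack k x * step_vec n (node (Suc k)) i)"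
      using that sl node_sum
      by (intro sum_mono mult_left_mono step_vec_antimono) (auto simp: less_imp_le)
    then show ?thesis using slack_expansion[OF xR] by metis
  qed
  then have dec: "x j < x i" if "i < j" "j < n" for i j
    using ne[of i j] that by (metis less_le less_trans)
  have "x i + x j \<noteq> 0" if "i \<le> j" "j < n" for i j
    using ne[of i j] nz[of i] that by (cases "i = j") auto
  then show "x \<in> arr_complement n"
    using xR dec by (auto simp: arr_complement_def Wint_def lam_ker_def)
qed

text \<open>Up to sign, a slack is one entry (last step), a sum of two entries (steps of different
  kinds) or a difference of entries at distinct positions (steps of the same kind). None of these
  vanishes off the hyperplanes and inside the Weyl chamber.\<close>

lemma slack_nonzero:
  assumes "x \<in> arr_complement n" "k < n"
  shows "slack k x \<noteq> 0"
proof -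
  have dec: "x i \<noteq> x j" if "i \<noteq> j" "i < n" "j < n" for i j
    using assms(1) that unfolding arr_complement_def Wint_def
    by (metis (mono_tags, lifting) DiffD1 linorder_neqE_nat mem_Collect_eq order_less_irrefl)
  have le: "x i + x j \<noteq> 0" if "i \<le> j" "j < n" for i j
    using assms(1) that by (auto simp: arr_complement_def Wint_def lam_ker_def)
  then have sum: "x i + x j \<noteq> 0" if "i < n" "j < n" for i j
    using that by (metis add.commute linear)
  have nz: "x i \<noteq> 0" if "i < n" for i using sum[of i i] that by auto
  have P: "pos k < n" using pos_less assms by simp
  show ?thesis
  proof (cases "Suc k < n")
    case False
    then show ?thesis using nz[OF P] assms by (auto simp: slack_def coord_def)
  next
    case True
    then have P': "pos (Suc k) < n" using pos_less by simp
    have eq: "pos k \<noteq> pos (Suc k)"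
      if "p (Suc k) = p k \<longleftrightarrow> p (Suc (Suc k)) = p (Suc k)"
    proof (cases "p (Suc k) = p k")
      case True
      then have "pos k = n - 1 - (k - p k)" "pos (Suc k) = n - 1 - (Suc k - p k)"
        using that by (simp_all add: pos_def)
      then show ?thesis using \<open>Suc k < n\<close> p_le[of k] by linarith
    next
      case False
      then show ?thesis using that unfolding pos_def by simp
    qed
    show ?thesis
      using dec[OF _ P P'] sum[OF P P'] eq True assms
      by (auto simp: slack_def coord_def add_eq_0_iff)
  qed
qed

lemma continuous_on_slack: "continuous_on S (slack k)"
proof -
  have "continuous_on S (coord j)" for j
    unfolding coord_def
    by (cases "j < n"; cases "p (Suc j) = p j")
      (auto intro!: continuous_intros continuous_on_product_coordinates
        intro: continuous_on_subset[OF continuous_on_product_coordinates])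
  then show ?thesis unfolding slack_def by (intro continuous_intros)
qed

lemma slack_add: "slack k (\<lambda>i. a * x i + b * y i) = a * slack k x + b * slack k y"
  by (simp add: slack_def coord_def algebra_simps)

lemma continuous_on_line: "continuous_on S (\<lambda>s i. f s * x i + h s * (y i :: real))"
  if "continuous_on S f" "continuous_on S h" for x y :: "nat \<Rightarrow> real"
  by (intro continuous_on_coordinatewise_then_product continuous_intros that)

text \<open>Slacks are linear, so along the segment between two points of the cell each slack stays
  positive.\<close>

lemma connected_open_cell: "connected open_cell"
  unfolding connected_iff_connected_component
proof (intro ballI)
  fix x y assume xy: "x \<in> open_cell" "y \<in> open_cell"
  define f where "f s i = (1 - s) * x i + s * y i" for s :: real and i
  have "connected (f ` {0..1})"
    unfolding f_def by (intro connected_continuous_image continuous_on_line continuous_intros) auto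
  moreover have "f ` {0..1} \<subseteq> open_cell"
  proof
    fix z assume "z \<in> f ` {0..1}"
    then obtain s where s: "0 \<le> s" "s \<le> 1" "z = f s" by auto
    have "0 < (1 - s) * slack k x + s * slack k y" if "k < n" for k
      using s xy that unfolding open_cell_def
      by (cases "s = 0") (auto intro!: add_nonneg_pos mult_nonneg_nonneg simp: less_imp_le)
    then show "z \<in> open_cell"
      using s xy unfolding f_def open_cell_def by (auto simp: slack_add Rn_def)
  qed
  moreover have "f 0 = x" "f 1 = y" by (simp_all add: f_def fun_eq_iff)
  then have "x \<in> f ` {0..1}" "y \<in> f ` {0..1}" by force+
  ultimately show "connected_component open_cell x y"
    unfolding connected_component_def by blast
qed

text \<open>Each slack maps the component to a connected set of reals that avoids 0 and contains a
  positive value, so it stays positive on the whole component.\<close>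

lemma component_eq_open_cell:
  assumes "x \<in> open_cell"
  shows "connected_component_set (arr_complement n) x = open_cell"
proof
  show "open_cell \<subseteq> connected_component_set (arr_complement n) x"
    by (intro connected_component_maximal assms connected_open_cell open_cell_subset)
next
  let ?K = "connected_component_set (arr_complement n) x"
  show "?K \<subseteq> open_cell"
  proof
    fix y assume y: "y \<in> ?K"
    have xK: "x \<in> ?K" using assms open_cell_subset by (simp add: subset_eq)
    have sub: "?K \<subseteq> arr_complement n" by (rule connected_component_subset)
    have "0 < slack k y" if k: "k < n" for k
    proof (rule ccontr)
      assume "\<not> 0 < slack k y"
      moreover have "0 < slack k x" using assms k by (simp add: open_cell_def)
      moreover have "connected (slack k ` ?K)"
        by (intro connected_continuous_image continuous_on_slack connected_connected_component)
      ultimately have "0 \<in> slack k ` ?K"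
        using connectedD_interval[of "slack k ` ?K" "slack k y" "slack k x" 0] xK y by force
      then show False using sub slack_nonzero k by fastforce
    qed
    moreover have "y \<in> Rn n" using y sub by (auto simp: arr_complement_def Wint_def)
    ultimately show "y \<in> open_cell" by (simp add: open_cell_def)
  qed
qed

lemma open_cell_nonempty: "open_cell \<noteq> {}"
proof -
  have "(\<lambda>i. \<Sum>l<n. 1 * step_vec n (node (Suc l)) i) \<in> open_cell"
    unfolding open_cell_def
    using node_sum_in_Rn[of "{..<n}" "\<lambda>_. 1"] slack_node_sum[of _ "{..<n}" "\<lambda>_. 1"] by simp
  then show ?thesis by blast
qed

text \<open>For the harder inclusion, a point x of the closed cell is the limit of x + s z as s > 0
  tends to 0, with z fixed in the open cell.\<close>

lemma closure_open_cell: "closure open_cell = closed_cell"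
proof
  have "closed {x. slack k x \<ge> 0}" for k
    by (intro closed_Collect_le continuous_on_slack continuous_intros)
  moreover have "closed (Rn n)"
    unfolding Rn_def
    by (intro closed_Collect_all closed_Collect_imp closed_Collect_eq continuous_intros
        continuous_on_product_coordinates) auto
  ultimately have "closed (Rn n \<inter> (\<Inter>k\<in>{..<n}. {x. slack k x \<ge> 0}))"
    by auto
  also have "Rn n \<inter> (\<Inter>k\<in>{..<n}. {x. slack k x \<ge> 0}) = closed_cell"
    by (auto simp: closed_cell_def)
  finally show "closure open_cell \<subseteq> closed_cell"
    by (intro closure_minimal) (auto simp: open_cell_def closed_cell_def less_imp_le)
next
  obtain z where z: "z \<in> open_cell" using open_cell_nonempty by blast
  show "closed_cell \<subseteq> closure open_cell"
  proof
    fix x assume x: "x \<in> closed_cell"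
    define f where "f s i = 1 * x i + s * z i" for s :: real and i
    have "f ` closure {0<..<1} \<subseteq> closure open_cell"
    proof (rule image_closure_subset)
      show "continuous_on (closure {0<..<1}) f"
        unfolding f_def by (intro continuous_on_line continuous_intros)
      have "f s \<in> open_cell" if "0 < s" for s
        using x z that unfolding f_def open_cell_def closed_cell_def mem_Collect_eq slack_add
        by (auto simp: Rn_def intro!: add_nonneg_pos)
      then show "f ` {0<..<1} \<subseteq> closure open_cell"
        using closure_subset by fastforce
    qed simp
    moreover have "f 0 = x" by (simp add: f_def fun_eq_iff)
    ultimately show "x \<in> closure open_cell" by (force simp: closure_greaterThanLessThan)
  qed
qed


section \<open>Faces of a closed cell\<close>

lemma sum_slack_functional:
  assumes "finite K"
  shows "\<exists>a. \<forall>x. (\<Sum>k\<in>K. slack k x) = (\<Sum>i<n. a i * x i)"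
proof -
  have coord: "\<exists>a. \<forall>x. coord j x = (\<Sum>i<n. a i * x i)" for j
  proof (cases "j < n")
    case True
    define e :: real where "e = (if p (Suc j) = p j then -1 else 1)"
    have "coord j x = (\<Sum>i<n. (if i = pos j then e else 0) * x i)" for x
      using True pos_less[OF True]
      by (simp add: coord_def e_def if_distrib[of "\<lambda>c. c * _"] cong: if_cong)
    then show ?thesis by (intro exI[of _ "\<lambda>i. if i = pos j then e else 0"]) blast
  next
    case False
    then show ?thesis by (intro exI[of _ "\<lambda>_. 0"]) (simp add: coord_def)
  qed
  then obtain A where A: "\<And>j x. coord j x = (\<Sum>i<n. A j i * x i)" by metis
  have "(\<Sum>k\<in>K. slack k x) = (\<Sum>i<n. (\<Sum>k\<in>K. A k i - A (Suc k) i) * x i)" for x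
  proof -
    have "(\<Sum>k\<in>K. slack k x) = (\<Sum>k\<in>K. \<Sum>i<n. (A k i - A (Suc k) i) * x i)"
      by (simp add: slack_def A left_diff_distrib sum_subtractf)
    also have "\<dots> = (\<Sum>i<n. \<Sum>k\<in>K. (A k i - A (Suc k) i) * x i)" by (rule sum.swap)
    finally show ?thesis by (simp add: sum_distrib_right)
  qed
  then show ?thesis by (intro exI[of _ "\<lambda>i. \<Sum>k\<in>K. A k i - A (Suc k) i"]) blast
qed

lemma step_vec_node_in_closed_cell: "k < n \<Longrightarrow> step_vec n (node (Suc k)) \<in> closed_cell"
  using step_vec_in_Rn[of "node (Suc k)" n] node_sum[of "Suc k"]
  by (simp add: closed_cell_def slack_step_vec_node)

text \<open>A functional supporting a cone is nonpositive on the generators. It therefore vanishes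
  at a point of the cone exactly when the slacks of all generators with negative value are 0; K
  collects the other generators.\<close>

lemma supporting_hyperplane_face:
  assumes "supporting_hyperplane n closed_cell H"
  shows "\<exists>K\<subseteq>{..<n}. closed_cell \<inter> H = grid_cone n ((\<lambda>k. node (Suc k)) ` K)"
proof -
  obtain a b where H: "H = hyperplane_n n a b"
    and le: "\<And>x. x \<in> closed_cell \<Longrightarrow> (\<Sum>i<n. a i * x i) \<le> b"
    and ne: "closed_cell \<inter> H \<noteq> {}"
    using assms unfolding supporting_hyperplane_def by blast
  define f where "f x = (\<Sum>i<n. a i * x i)" for x :: "nat \<Rightarrow> real"
  have scale: "(\<lambda>i. r * x i) \<in> closed_cell" if "x \<in> closed_cell" "0 \<le> r" for r x
    using that slack_add[of _ r x 0 x] by (auto simp: closed_cell_def Rn_def)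
  have f_scale: "f (\<lambda>i. r * x i) = r * f x" for r x
    by (simp add: f_def sum_distrib_left mult.left_commute)
  obtain x where x: "x \<in> closed_cell" "f x = b"
    using ne H by (auto simp: hyperplane_n_def f_def)
  \<comment> \<open>Scaling the contact point, where \<open>f\<close> has the value b, by 0 and by 2
    stays in the cone and forces b = 0.\<close>
  have "0 * f x \<le> b" "2 * f x \<le> b"
    using le[OF scale[OF x(1)], of 0] le[OF scale[OF x(1)], of 2]
    unfolding f_def[symmetric] f_scale by simp_all
  then have b: "b = 0" using x by simp
  let ?u = "\<lambda>k. step_vec n (node (Suc k))"
  have fu: "f (?u k) \<le> 0" if "k < n" for k
    using le[OF step_vec_node_in_closed_cell[OF that]] b by (simp add: f_def)
  have f_eq: "f x = (\<Sum>k<n. slack k x * f (?u k))" if "x \<in> Rn n" for x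
  proof -
    have "f x = f (\<lambda>i. \<Sum>k<n. slack k x * ?u k i)" using slack_expansion[OF that] by simp
    also have "\<dots> = (\<Sum>i<n. \<Sum>k<n. a i * (slack k x * ?u k i))"
      by (simp add: f_def sum_distrib_left)
    also have "\<dots> = (\<Sum>k<n. \<Sum>i<n. a i * (slack k x * ?u k i))" by (rule sum.swap)
    also have "\<dots> = (\<Sum>k<n. slack k x * f (?u k))"
      by (simp add: f_def sum_distrib_left mult.left_commute)
    finally show ?thesis .
  qed
  define K where "K = {k. k < n \<and> f (?u k) = 0}"
  have "f x = 0 \<longleftrightarrow> (\<forall>k<n. k \<notin> K \<longrightarrow> slack k x = 0)" if "x \<in> closed_cell" for x
  proof -
    \<comment> \<open>After the change of sign every summand is nonnegative, so the sum vanishes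
      only termwise.\<close>
    have "f x = 0 \<longleftrightarrow> (\<Sum>k<n. slack k x * - f (?u k)) = 0"
      using that f_eq[of x] by (simp add: closed_cell_def sum_negf)
    also have "\<dots> \<longleftrightarrow> (\<forall>k\<in>{..<n}. slack k x * - f (?u k) = 0)"
      using that fu by (intro sum_nonneg_eq_0_iff) (auto simp: closed_cell_def mult_nonneg_nonpos)
    finally show ?thesis by (auto simp: K_def)
  qed
  then have "closed_cell \<inter> H = {x \<in> closed_cell. \<forall>k<n. k \<notin> K \<longrightarrow> slack k x = 0}"
    using H b by (auto simp: hyperplane_n_def f_def closed_cell_def)
  moreover have "K \<subseteq> {..<n}" by (auto simp: K_def)
  ultimately show ?thesis by (intro exI[of _ K]) (simp add: grid_cone_nodes)
qed

text \<open>The hyperplane is the zero set of the sum of the slacks outside K, with coefficients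
  from \<open>sum_slack_functional\<close> and the sign changed so that the cell lies on the
  nonpositive side.\<close>

lemma face_supporting_hyperplane:
  assumes "K \<subseteq> {..<n}" "K \<noteq> {..<n}"
  shows "\<exists>H. supporting_hyperplane n closed_cell H \<and>
             grid_cone n ((\<lambda>k. node (Suc k)) ` K) = closed_cell \<inter> H"
proof -
  obtain a where a: "\<And>x. (\<Sum>k\<in>{..<n} - K. slack k x) = (\<Sum>i<n. a i * x i)"
    using sum_slack_functional[of "{..<n} - K"] by auto
  have neg: "(\<Sum>i<n. - a i * x i) = - (\<Sum>k\<in>{..<n} - K. slack k x)" for x
    by (simp add: a sum_negf)
  have nonneg: "0 \<le> (\<Sum>k\<in>{..<n} - K. slack k x)" if "x \<in> closed_cell" for x
    using that by (intro sum_nonneg) (auto simp: closed_cell_def)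
  define H where "H = hyperplane_n n (\<lambda>i. - a i) 0"
  have "\<exists>i<n. - a i \<noteq> 0"
  proof (rule ccontr)
    assume *: "\<not> (\<exists>i<n. - a i \<noteq> 0)"
    \<comment> \<open>The sum of slacks has the value 1 at the step vector of a node missing from K,
      so its coefficients cannot all be 0.\<close>
    obtain l where l: "l < n" "l \<notin> K" using assms by blast
    have "(\<Sum>k\<in>{..<n} - K. slack k (step_vec n (node (Suc l))))
        = (\<Sum>k\<in>{..<n} - K. if k = l then 1 else 0)"
      using l by (intro sum.cong) (auto simp: slack_step_vec_node)
    also have "\<dots> = 1" using l by simp
    finally show False using * a by simp
  qed
  moreover have face: "grid_cone n ((\<lambda>k. node (Suc k)) ` K) = closed_cell \<inter> H"
  proof -
    have "(\<Sum>k\<in>{..<n} - K. slack k x) = 0 \<longleftrightarrow> (\<forall>k\<in>{..<n} - K. slack k x = 0)"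
      if "x \<in> closed_cell" for x
      using that by (intro sum_nonneg_eq_0_iff) (auto simp: closed_cell_def)
    then show ?thesis
      unfolding grid_cone_nodes[OF assms(1)] H_def hyperplane_n_def neg
      by (auto simp: closed_cell_def)
  qed
  moreover have "grid_cone n ((\<lambda>k. node (Suc k)) ` K) \<noteq> {}"
    by (auto simp: grid_cone_def intro: exI[of _ "\<lambda>_. 0"])
  ultimately have "supporting_hyperplane n closed_cell H"
    unfolding supporting_hyperplane_def H_def using neg nonneg
    by (intro exI[of _ "\<lambda>i. - a i"] exI[of _ 0]) auto
  then show ?thesis using face by blast
qed

text \<open>The spanning vectors of a cone are recovered from it as those step vectors that it contains:
  the slacks of a step vector in the cone are nonnegative integers with sum at most 1.\<close>

lemma step_vec_in_cone_nodes:
  assumes K: "K \<subseteq> {..<n}" and v: "v \<in> grid n"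
    and w: "step_vec n v \<in> grid_cone n ((\<lambda>k. node (Suc k)) ` K)"
  shows "v \<in> (\<lambda>k. node (Suc k)) ` K"
proof -
  let ?w = "step_vec n v"
  have vn: "fst v + snd v \<le> n" "fst v + snd v \<noteq> 0" using v by (auto simp: grid_def)
  have wR: "?w \<in> Rn n" and nn: "\<And>k. k < n \<Longrightarrow> 0 \<le> slack k ?w"
    and out: "\<And>k. k < n \<Longrightarrow> k \<notin> K \<Longrightarrow> slack k ?w = 0"
    using w unfolding grid_cone_nodes[OF K] by (auto simp: closed_cell_def)
  have val: "coord j ?w \<in> {-1, 0, 1}" for j
    by (auto simp: coord_def step_vec_def)
  have "\<exists>k<n. slack k ?w \<noteq> 0"
  proof (rule ccontr)
    assume "\<not> ?thesis"
    then have "slack k ?w = 0" if "k < n" for k using that by blast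
    \<comment> \<open>With all slacks 0 the vector would be zero, which is the step vector of the
      node (0, 0) excluded from the grid.\<close>
    moreover have "step_vec n (0, 0) = (\<lambda>_. 0)" by (auto simp: step_vec_def fun_eq_iff)
    then have "slack k (step_vec n (0, 0)) = 0" for k by (simp add: slack_def coord_def)
    ultimately have "slack k ?w = slack k (step_vec n (0, 0))" if "k < n" for k using that by simp
    then have "?w = step_vec n (0, 0)"
      by (intro eq_if_slack_eq wR step_vec_in_Rn) auto
    then show False using step_vec_inject[of v n "(0, 0)"] vn by simp
  qed
  then obtain k where k: "k < n" "slack k ?w \<noteq> 0" by blast
  then have "0 < slack k ?w" using nn[of k] by simp
  then have ge1: "1 \<le> slack k ?w"
    using val[of k] val[of "Suc k"] by (auto simp: slack_def)
  \<comment> \<open>The slacks telescope to \<open>coord 0\<close>, whose value here is at most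
    1.\<close>
  have "(\<Sum>i<n. slack i ?w) \<le> 1"
    using coord_eq_sum_slack[of 0 ?w] val[of 0] by (auto simp: atLeast0LessThan)
  then have "slack k ?w + (\<Sum>i\<in>{..<n} - {k}. slack i ?w) \<le> 1"
    using k by (subst (asm) sum.remove[of _ k]) auto
  moreover have "0 \<le> (\<Sum>i\<in>{..<n} - {k}. slack i ?w)"
    using nn by (intro sum_nonneg) auto
  ultimately have "slack k ?w = 1" "(\<Sum>i\<in>{..<n} - {k}. slack i ?w) = 0"
    using ge1 by linarith+
  moreover from this(2) have "\<forall>i\<in>{..<n} - {k}. slack i ?w = 0"
    using nn by (subst (asm) sum_nonneg_eq_0_iff) auto
  ultimately have "slack i ?w = slack i (step_vec n (node (Suc k)))" if "i < n" for i
    using that k by (auto simp: slack_step_vec_node)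
  then have "?w = step_vec n (node (Suc k))"
    using node_sum[of "Suc k"] k by (intro eq_if_slack_eq wR step_vec_in_Rn) auto
  then have "v = node (Suc k)"
    using step_vec_inject[of v n "node (Suc k)"] vn node_sum[of "Suc k"] k by simp
  then show ?thesis using k out by blast
qed

end

section \<open>Chambers and faces of the arrangement\<close>

lemma lattice_path_cell_exists:
  assumes "x \<in> arr_complement n"
  shows "\<exists>p. lattice_path p \<and> x \<in> lattice_path.open_cell n p"
proof -
  \<comment> \<open>x m and x (n - 1 - (j - m)) are the outermost remaining coordinates; as x is decreasing, their
    sum is positive iff the one of larger absolute value is positive\<close>
  define p where "p = rec_nat 0 (\<lambda>j m. if x m + x (n - 1 - (j - m)) > 0 then Suc m else m)"
  have p0: "p 0 = 0" by (simp add: p_def)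
  have pS: "p (Suc j) = (if x (p j) + x (n - 1 - (j - p j)) > 0 then Suc (p j) else p j)" for j
    by (simp add: p_def)
  interpret lattice_path n p
    by unfold_locales (auto simp: p0 pS)
  have xR: "x \<in> Rn n" and dec: "\<And>i j. i < j \<Longrightarrow> j < n \<Longrightarrow> x j < x i"
    using assms by (auto simp: arr_complement_def Wint_def)
  have le: "x i + x j \<noteq> 0" if "i \<le> j" "j < n" for i j
    using assms that by (auto simp: arr_complement_def Wint_def lam_ker_def)
  have "0 < slack k x" if k: "k < n" for k
  proof -
    define m where "m = n - 1 - (k - p k)"
    have m: "p k \<le> m" "m < n" using p_le[of k] k by (auto simp: m_def)
    have up_iff: "p (Suc k) \<noteq> p k \<longleftrightarrow> 0 < x (p k) + x m" by (simp add: pS m_def)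
    have nz: "x (p k) + x m \<noteq> 0" using le m by blast
    have ck: "coord k x = (if 0 < x (p k) + x m then x (p k) else - x m)"
      using k up_iff by (auto simp: coord_def pos_def m_def)
    show ?thesis
    proof (cases "Suc k < n")
      case False
      \<comment> \<open>In the last step a single index remains, so both outermost indices coincide
        and \<open>slack\<close> is the absolute value of that entry.\<close>
      then have "m = p k" using k p_le[of k] by (auto simp: m_def)
      then show ?thesis using ck nz False by (auto simp: slack_def coord_def)
    next
      case True
      have lt: "p k < m" using True p_le[of k] by (auto simp: m_def)
      show ?thesis
      proof (cases "0 < x (p k) + x m")
        case up: True
        \<comment> \<open>After a left step the next value is \<open>- x m\<close>, smaller since
          the tested sum is positive, or \<open>x (Suc (p k))\<close>, smaller since x decreases.
          The other case is symmetric.\<close>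
        then have S: "p (Suc k) = Suc (p k)" using up_iff p_step by blast
        have "coord (Suc k) x = (if p (Suc (Suc k)) = p (Suc k) then - x m else x (Suc (p k)))"
          using True S by (simp add: coord_def pos_def m_def)
        then show ?thesis using ck up dec[of "p k" "Suc (p k)"] lt m by (auto simp: slack_def)
      next
        case down: False
        then have S: "p (Suc k) = p k" using up_iff by blast
        have "n - 1 - (Suc k - p k) = m - 1" using p_le[of k] by (simp add: m_def)
        then have "coord (Suc k) x = (if p (Suc (Suc k)) = p (Suc k) then - x (m - 1) else x (p k))"
          using True S by (simp add: coord_def pos_def)
        then show ?thesis using ck down nz dec[of "m - 1" m] lt m by (auto simp: slack_def)
      qed
    qed
  qed
  then show ?thesis using xR lattice_path_axioms by (auto simp: open_cell_def)
qed

lemma chambers_eq: "chambers n = {lattice_path.closed_cell n p | p. lattice_path p}"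
proof (intro equalityI subsetI)
  fix C assume "C \<in> chambers n"
  then obtain x where x: "x \<in> arr_complement n"
    "C = closure (connected_component_set (arr_complement n) x)"
    by (auto simp: chambers_def)
  obtain p where p: "lattice_path p" "x \<in> lattice_path.open_cell n p"
    using lattice_path_cell_exists[OF x(1)] by blast
  then show "C \<in> {lattice_path.closed_cell n p | p. lattice_path p}"
    using x lattice_path.component_eq_open_cell lattice_path.closure_open_cell by fastforce
next
  fix C assume "C \<in> {lattice_path.closed_cell n p | p. lattice_path p}"
  then obtain p where p: "lattice_path p" "C = lattice_path.closed_cell n p" by blast
  interpret lattice_path n p by (rule p(1))
  obtain x where x: "x \<in> open_cell" using open_cell_nonempty by blast
  have "C = closure (connected_component_set (arr_complement n) x)"
    by (simp add: p(2) component_eq_open_cell[OF x] closure_open_cell)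
  then show "C \<in> chambers n"
    using x open_cell_subset unfolding chambers_def by blast
qed

lemma grid_chain_in_path:
  assumes "T \<subseteq> grid n" "grid_chain T"
  shows "\<exists>p K. lattice_path p \<and> K \<subseteq> {..<n} \<and> T = (\<lambda>k. lattice_path.node p (Suc k)) ` K"
proof -
  \<comment> \<open>increment the first component whenever all elements of T still ahead stay above the path\<close>
  define p where
    "p = rec_nat 0 (\<lambda>j m. if \<forall>v\<in>T. j < fst v + snd v \<longrightarrow> m < fst v then Suc m else m)"
  have p0: "p 0 = 0" by (simp add: p_def)
  have pS: "p (Suc j) = (if \<forall>v\<in>T. j < fst v + snd v \<longrightarrow> p j < fst v then Suc (p j) else p j)" for j
    by (simp add: p_def)
  interpret lattice_path n p
    by unfold_locales (auto simp: p0 pS)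
  \<comment> \<open>Invariant: the path stays componentwise below all elements of T still ahead. At
    time \<open>fst v + snd v\<close> this forces it to be at v.\<close>
  have below: "\<forall>v\<in>T. j \<le> fst v + snd v \<longrightarrow> p j \<le> fst v \<and> j - p j \<le> snd v" for j
  proof (induction j)
    case 0
    then show ?case by (simp add: p0)
  next
    case (Suc j)
    show ?case
    proof (cases "\<forall>v\<in>T. j < fst v + snd v \<longrightarrow> p j < fst v")
      case True
      then have "p (Suc j) = Suc (p j)" by (simp add: pS)
      then show ?thesis using True Suc by (auto simp: Suc_le_eq)
    next
      case False
      then have S: "p (Suc j) = p j" by (simp only: pS if_False)
      obtain v where v: "v \<in> T" "j < fst v + snd v" "\<not> p j < fst v" using False by blast
      \<comment> \<open>The element v that blocks the increment has first component
        \<open>p j\<close>. Any w still ahead lies above v or has first component at most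
        \<open>p j\<close>; in both cases its second component leaves room for the right
        step.\<close>
      then have pv: "fst v = p j" using Suc by fastforce
      have "Suc j - p j \<le> snd w" if w: "w \<in> T" "Suc j \<le> fst w + snd w" for w
        using assms(2) v w pv unfolding grid_chain_def by fastforce
      then show ?thesis using S Suc by simp
    qed
  qed
  have T_node: "v = node (fst v + snd v)" if "v \<in> T" for v
    using below[of "fst v + snd v"] that p_le[of "fst v + snd v"]
    by (auto simp: node_def prod_eq_iff)
  define K where "K = {k. k < n \<and> node (Suc k) \<in> T}"
  have "v \<in> (\<lambda>k. node (Suc k)) ` K" if "v \<in> T" for v
  proof -
    have "fst v + snd v \<noteq> 0" "fst v + snd v \<le> n" using assms(1) that by (auto simp: grid_def)
    then obtain k where k: "fst v + snd v = Suc k" "k < n" by (metis Suc_le_lessD not0_implies_Suc)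
    then show ?thesis
      using T_node[OF that] that unfolding K_def by (metis (mono_tags, lifting) image_eqI mem_Collect_eq)
  qed
  then have "T = (\<lambda>k. node (Suc k)) ` K" by (auto simp: K_def)
  moreover have "K \<subseteq> {..<n}" by (auto simp: K_def)
  ultimately show ?thesis using lattice_path_axioms by blast
qed

text \<open>The faces of a closed cell are the cones on sets of nonzero nodes of its path, the full
  set giving the chamber itself. Every such set is a chain, and every chain in the grid lies on some
  path.\<close>

lemma faces_eq: "faces n = grid_cone n ` {T. T \<subseteq> grid n \<and> grid_chain T}"
proof (intro equalityI subsetI)
  fix F assume "F \<in> faces n"
  then obtain C where C: "C \<in> chambers n"
    "F = C \<or> (\<exists>H. supporting_hyperplane n C H \<and> F = C \<inter> H)"
    by (auto simp: faces_def)
  then obtain p where p: "lattice_path p" "C = lattice_path.closed_cell n p"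
    by (auto simp: chambers_eq)
  interpret lattice_path n p by (rule p(1))
  obtain K where K: "K \<subseteq> {..<n}" "F = grid_cone n ((\<lambda>k. node (Suc k)) ` K)"
    using C(2) supporting_hyperplane_face grid_cone_all_nodes unfolding p(2) by blast
  have "(\<lambda>k. node (Suc k)) ` K = node ` Suc ` K" by (simp add: image_image)
  then have "grid_chain ((\<lambda>k. node (Suc k)) ` K)" using grid_chain_nodes by metis
  moreover have "(\<lambda>k. node (Suc k)) ` K \<subseteq> grid n" using K(1) node_in_grid by auto
  ultimately show "F \<in> grid_cone n ` {T. T \<subseteq> grid n \<and> grid_chain T}"
    using K(2) by blast
next
  fix F assume "F \<in> grid_cone n ` {T. T \<subseteq> grid n \<and> grid_chain T}"
  then obtain T where T: "T \<subseteq> grid n" "grid_chain T" "F = grid_cone n T" by blast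
  then obtain p K where p: "lattice_path p" "K \<subseteq> {..<n}"
    "T = (\<lambda>k. lattice_path.node p (Suc k)) ` K"
    using grid_chain_in_path by blast
  interpret lattice_path n p by (rule p(1))
  have "closed_cell \<in> chambers n" using p(1) by (auto simp: chambers_eq)
  moreover have "F = closed_cell \<or> (\<exists>H. supporting_hyperplane n closed_cell H \<and> F = closed_cell \<inter> H)"
    using face_supporting_hyperplane[OF p(2)] grid_cone_all_nodes T(3) p(3) by metis
  ultimately show "F \<in> faces n" unfolding faces_def by blast
qed

section \<open>Cones determine their chains; dimension of a cone\<close>

lemma step_vec_in_grid_cone:
  assumes "finite T" "v \<in> T" shows "step_vec n v \<in> grid_cone n T"
proof -
  have "step_vec n v = (\<lambda>i. \<Sum>w\<in>T. (if w = v then 1 else 0) * step_vec n w i)"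
    using assms by (simp add: if_distrib[of "\<lambda>c. c * _"] cong: if_cong)
  then show ?thesis
    unfolding grid_cone_def by (intro CollectI exI[of _ "\<lambda>w. if w = v then 1 else 0"]) auto
qed

text \<open>A chain is recovered from its cone as the set of grid nodes whose step vectors lie in
  the cone, by \<open>step_vec_in_cone_nodes\<close>.\<close>

lemma inj_on_grid_cone: "inj_on (grid_cone n) {T. T \<subseteq> grid n \<and> grid_chain T}"
proof -
  have sub: "S \<subseteq> T" if S: "S \<subseteq> grid n" and T: "T \<subseteq> grid n" "grid_chain T"
    and eq: "grid_cone n S = grid_cone n T" for S T
  proof
    fix v assume v: "v \<in> S"
    obtain p K where p: "lattice_path p" "K \<subseteq> {..<n}"
      "T = (\<lambda>k. lattice_path.node p (Suc k)) ` K"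
      using grid_chain_in_path[OF T] by blast
    have "step_vec n v \<in> grid_cone n T"
      using step_vec_in_grid_cone[of S v n] v S finite_subset[OF S finite_grid] eq by simp
    then show "v \<in> T"
      using lattice_path.step_vec_in_cone_nodes[OF p(1,2)] v S unfolding p(3) by blast
  qed
  show ?thesis
    by (rule inj_onI, rule equalityI) (auto intro: sub[THEN subsetD])
qed

interpretation fscale: vector_space fscale
  by unfold_locales (auto simp: fscale_def fun_eq_iff algebra_simps)

lemma sum_fscale_apply: "(\<Sum>v\<in>T. fscale (c v) (f v)) = (\<lambda>i. \<Sum>v\<in>T. c v * f v i)"
  by (induction T rule: infinite_finite_induct) (auto simp: fscale_def fun_eq_iff)

text \<open>The cone and its generators have the same span. The generators are independent because,
  along a path through T, applying a slack to a vanishing combination reads off one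
  coefficient.\<close>

lemma span_dim_grid_cone:
  assumes "T \<subseteq> grid n" "grid_chain T"
  shows "span_dim (grid_cone n T) = card T"
proof -
  have fin: "finite T" using assms(1) finite_grid finite_subset by blast
  obtain p K where p: "lattice_path p" "K \<subseteq> {..<n}"
    "T = (\<lambda>k. lattice_path.node p (Suc k)) ` K"
    using grid_chain_in_path[OF assms] by blast
  interpret lattice_path n p by (rule p(1))
  have inj: "inj_on (step_vec n) T"
  proof (rule inj_onI)
    fix v w assume "v \<in> T" "w \<in> T" "step_vec n v = step_vec n w"
    moreover from this have "fst v + snd v \<le> n" "fst w + snd w \<le> n"
      using assms(1) by (auto simp: grid_def)
    ultimately show "v = w" using step_vec_inject by blast
  qed
  have injK: "inj_on (\<lambda>k. node (Suc k)) K" by (simp add: inj_on_def node_inj)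
  have "grid_cone n T \<subseteq> fscale.span (step_vec n ` T)"
    unfolding grid_cone_def sum_fscale_apply[symmetric]
    by (auto intro!: fscale.span_sum fscale.span_scale intro: fscale.span_base)
  moreover have "step_vec n ` T \<subseteq> grid_cone n T"
    using step_vec_in_grid_cone[OF fin] by auto
  ultimately have "fscale.span (grid_cone n T) = fscale.span (step_vec n ` T)"
    by (metis fscale.span_mono fscale.span_span subset_antisym)
  moreover have "fscale.independent (step_vec n ` T)"
  proof (rule fscale.independent_if_scalars_zero)
    fix c x assume 0: "(\<Sum>x\<in>step_vec n ` T. fscale (c x) x) = 0" and x: "x \<in> step_vec n ` T"
    obtain k where k: "k \<in> K" "x = step_vec n (node (Suc k))" using x p(3) by auto
    define d where "d l = c (step_vec n (node (Suc l)))" for l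
    have "(\<Sum>x\<in>step_vec n ` T. fscale (c x) x)
        = (\<Sum>l\<in>K. fscale (d l) (step_vec n (node (Suc l))))"
      unfolding sum.reindex[OF inj] d_def by (simp add: p(3) sum.reindex[OF injK])
    then have "slack k (\<lambda>i. \<Sum>l\<in>K. d l * step_vec n (node (Suc l)) i) = slack k 0"
      using 0 by (simp add: sum_fscale_apply)
    moreover have "slack k 0 = 0" by (simp add: slack_def coord_def)
    ultimately show "c x = 0"
      using slack_node_sum[of k K d] k p(2) by (auto simp: d_def)
  qed (use fin in simp)
  ultimately show ?thesis
    unfolding span_dim_def using card_image[OF inj]
    by (simp add: fscale.dim_eq_card_independent)
qed

section \<open>Counting chains in the grid\<close>

definition grid_chains :: "nat \<Rightarrow> nat \<Rightarrow> (nat \<times> nat) set set" where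
  "grid_chains n k = {T. T \<subseteq> grid n \<and> grid_chain T \<and> card T = k}"

lemma g_eq_card_grid_chains: "g n k = card (grid_chains n k)"
proof -
  have "{F \<in> faces n. span_dim F = k} = grid_cone n ` grid_chains n k"
    unfolding faces_eq grid_chains_def by (auto simp: span_dim_grid_cone)
  moreover have "inj_on (grid_cone n) (grid_chains n k)"
    by (rule inj_on_subset[OF inj_on_grid_cone]) (auto simp: grid_chains_def)
  ultimately show ?thesis by (simp add: g_def card_image)
qed

lemma finite_grid_chains: "finite (grid_chains n k)"
  by (rule finite_subset[of _ "Pow (grid n)"]) (auto simp: grid_chains_def finite_grid)

lemma card_grid_chains_0: "card (grid_chains n 0) = 1"
proof -
  \<comment> \<open>Finiteness of the grid rules out infinite sets, whose \<open>card\<close> is 0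
    as well.\<close>
  have "grid_chains n 0 = {{}}"
    using finite_subset[OF _ finite_grid] by (auto simp: grid_chains_def grid_chain_def)
  then show ?thesis by simp
qed

text \<open>Translation by v: deleting the least element v and subtracting it from the others gives
  a chain in a smaller grid. These differences are nonzero, and their coordinate sums drop by that
  of v.\<close>

lemma card_grid_chains_least:
  assumes v: "v \<in> grid n"
  shows "card {T \<in> grid_chains n (Suc k). v \<in> T \<and> (\<forall>w\<in>T. fst v \<le> fst w \<and> snd v \<le> snd w)}
       = card (grid_chains (n - (fst v + snd v)) k)" (is "card ?A = card ?B")
proof -
  define sh where "sh w = (fst v + fst w, snd v + snd w)" for w :: "nat \<times> nat"
  define un where "un w = (fst w - fst v, snd w - snd v)" for w :: "nat \<times> nat"
  have un_sh: "un (sh w) = w" for w by (simp add: sh_def un_def)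
  have "bij_betw (\<lambda>T. insert v (sh ` T)) ?B ?A"
  proof (rule bij_betw_byWitness[where f' = "\<lambda>T. un ` (T - {v})"])
    \<comment> \<open>The grid omits (0, 0), so no translate of a grid node is v itself.\<close>
    have sh_ne: "sh w \<noteq> v" if "w \<in> grid m" for w m
      using that by (auto simp: sh_def grid_def prod_eq_iff)
    show "\<forall>T\<in>?B. un ` (insert v (sh ` T) - {v}) = T"
    proof
      fix T assume "T \<in> ?B"
      then have "v \<notin> sh ` T" using sh_ne by (fastforce simp: grid_chains_def)
      then have "insert v (sh ` T) - {v} = sh ` T" by blast
      then show "un ` (insert v (sh ` T) - {v}) = T" by (simp add: image_image un_sh)
    qed
    show "\<forall>T\<in>?A. insert v (sh ` un ` (T - {v})) = T"
    proof
      fix T assume T: "T \<in> ?A"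
      then have "sh (un w) = w" if "w \<in> T" for w
        using that by (auto simp: sh_def un_def prod_eq_iff)
      then have "sh ` un ` (T - {v}) = T - {v}" by (auto simp: image_image)
      then show "insert v (sh ` un ` (T - {v})) = T" using T by blast
    qed
    show "(\<lambda>T. insert v (sh ` T)) ` ?B \<subseteq> ?A"
    proof (intro image_subsetI)
      fix T assume T: "T \<in> ?B"
      then have fin: "finite T" using finite_subset[OF _ finite_grid] by (auto simp: grid_chains_def)
      have "v \<notin> sh ` T" using T sh_ne by (fastforce simp: grid_chains_def)
      moreover have "inj_on sh T" by (metis inj_on_def un_sh)
      ultimately have "card (insert v (sh ` T)) = Suc k"
        using T fin by (simp add: card_image grid_chains_def)
      moreover have "insert v (sh ` T) \<subseteq> grid n"
        using T v by (fastforce simp: grid_chains_def grid_def sh_def)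
      moreover have "grid_chain (insert v (sh ` T))"
        using T unfolding grid_chains_def grid_chain_def sh_def by auto
      ultimately show "insert v (sh ` T) \<in> ?A" by (auto simp: grid_chains_def sh_def)
    qed
    show "(\<lambda>T. un ` (T - {v})) ` ?A \<subseteq> ?B"
    proof (intro image_subsetI)
      fix T assume T: "T \<in> ?A"
      then have ge: "\<And>w. w \<in> T \<Longrightarrow> fst v \<le> fst w \<and> snd v \<le> snd w"
        and T': "T \<subseteq> grid n" "grid_chain T" "card T = Suc k" "v \<in> T"
        by (auto simp: grid_chains_def)
      have "inj_on un (T - {v})"
      proof (rule inj_onI)
        fix x y assume "x \<in> T - {v}" "y \<in> T - {v}" "un x = un y"
        then show "x = y" using ge[of x] ge[of y] by (auto simp: un_def prod_eq_iff)
      qed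
      then have "card (un ` (T - {v})) = k"
        using T' finite_subset[OF T'(1) finite_grid] by (simp add: card_image)
      moreover have "un w \<in> grid (n - (fst v + snd v))" if w: "w \<in> T" "w \<noteq> v" for w
      proof -
        have "fst v < fst w \<or> snd v < snd w"
          using ge[OF w(1)] w(2) by (auto simp: prod_eq_iff)
        moreover have "fst w + snd w \<le> n" using T'(1) w(1) by (auto simp: grid_def)
        ultimately show ?thesis using ge[OF w(1)] by (auto simp: un_def grid_def)
      qed
      then have "un ` (T - {v}) \<subseteq> grid (n - (fst v + snd v))" by blast
      moreover have "grid_chain (un ` (T - {v}))"
        unfolding grid_chain_def
      proof (intro ballI)
        fix x y assume "x \<in> un ` (T - {v})" "y \<in> un ` (T - {v})"
        then obtain x' y' where xy: "x' \<in> T" "y' \<in> T" "x = un x'" "y = un y'" by blast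
        then have "fst x' \<le> fst y' \<and> snd x' \<le> snd y' \<or> fst y' \<le> fst x' \<and> snd y' \<le> snd x'"
          using T'(2) unfolding grid_chain_def by blast
        then show "fst x \<le> fst y \<and> snd x \<le> snd y \<or> fst y \<le> fst x \<and> snd y \<le> snd x"
          unfolding xy un_def by (auto simp: diff_le_mono)
      qed
      ultimately show "un ` (T - {v}) \<in> ?B" by (simp add: grid_chains_def)
    qed
  qed
  then show ?thesis by (simp add: bij_betw_same_card)
qed

text \<open>A nonempty finite chain has exactly one least element; the chains are sorted by
  it.\<close>

lemma card_grid_chains_Suc:
  "card (grid_chains n (Suc k)) = (\<Sum>v\<in>grid n. card (grid_chains (n - (fst v + snd v)) k))"
proof -
  let ?A = "\<lambda>v. {T \<in> grid_chains n (Suc k). v \<in> T \<and> (\<forall>w\<in>T. fst v \<le> fst w \<and> snd v \<le> snd w)}"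
  have "grid_chains n (Suc k) = (\<Union>v\<in>grid n. ?A v)"
  proof (intro equalityI subsetI)
    fix T assume T: "T \<in> grid_chains n (Suc k)"
    then have T': "T \<subseteq> grid n" "grid_chain T" "T \<noteq> {}" "finite T"
      using finite_subset[OF _ finite_grid] by (auto simp: grid_chains_def)
    \<comment> \<open>By comparability, an element of minimal coordinate sum is least in both
      components.\<close>
    define v where "v = arg_min_on (\<lambda>w. fst w + snd w) T"
    have v: "v \<in> T" "\<And>w. w \<in> T \<Longrightarrow> fst v + snd v \<le> fst w + snd w"
      using T' arg_min_if_finite(1)[of T "\<lambda>w. fst w + snd w"]
        arg_min_least[of T _ "\<lambda>w. fst w + snd w"] by (auto simp: v_def)
    have "fst v \<le> fst w \<and> snd v \<le> snd w" if "w \<in> T" for w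
      using T'(2) v(1) v(2)[OF that] that unfolding grid_chain_def by fastforce
    then show "T \<in> (\<Union>v\<in>grid n. ?A v)" using T T' v(1) by blast
  qed auto
  also have "card \<dots> = (\<Sum>v\<in>grid n. card (?A v))"
  proof (rule card_UN_disjoint)
    show "\<forall>v\<in>grid n. \<forall>w\<in>grid n. v \<noteq> w \<longrightarrow> ?A v \<inter> ?A w = {}"
      by (auto simp: prod_eq_iff intro: order_antisym)
  qed (auto simp: finite_grid finite_grid_chains)
  also have "\<dots> = (\<Sum>v\<in>grid n. card (grid_chains (n - (fst v + snd v)) k))"
    by (intro sum.cong refl card_grid_chains_least)
  finally show ?thesis .
qed

text \<open>Exactly \<open>Suc m\<close> nodes (a, b) have coordinate sum m, one for each a from 0
  to m.\<close>

lemma sum_grid: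
  fixes h :: "nat \<Rightarrow> nat"
  shows "(\<Sum>v\<in>grid n. h (fst v + snd v)) = (\<Sum>m=1..n. Suc m * h m)"
proof -
  have "(\<Sum>m=1..n. Suc m * h m) = (\<Sum>m=1..n. \<Sum>a\<le>m. h m)" by simp
  also have "\<dots> = (\<Sum>(m, a)\<in>(SIGMA m:{1..n}. {..m}). h m)" by (rule sum.Sigma) auto
  also have "\<dots> = (\<Sum>v\<in>grid n. h (fst v + snd v))"
    by (rule sum.reindex_bij_witness[of _ "\<lambda>(a, b). (a + b, a)" "\<lambda>(m, a). (a, m - a)"])
      (auto simp: grid_def)
  finally show ?thesis by simp
qed

section \<open>Recurrence and generating function\<close>

lemma g_0: "g n 0 = 1"
  by (simp add: g_eq_card_grid_chains card_grid_chains_0)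

lemma g_Suc: "g n (Suc k) = (\<Sum>m=1..n. Suc m * g (n - m) k)"
  unfolding g_eq_card_grid_chains card_grid_chains_Suc
  by (rule sum_grid[of "\<lambda>m. card (grid_chains (n - m) k)"])

theorem theorem1p4:
  fixes s t :: "int fps fps"
  defines "s \<equiv> fps_X" and "t \<equiv> fps_const fps_X"
  shows "G * (1 - 2 * s + s ^ 2 - 2 * s * t + s ^ 2 * t) = 1 - s"
proof -
  define E :: "int fps fps" where "E = Abs_fps (\<lambda>_. 1)"
  have E: "E * (1 - s) = 1"
    by (rule fps_ext) (simp add: E_def s_def right_diff_distrib)
  \<comment> \<open>The coefficients of 1 / (1 - s)^2 count the nodes by coordinate sum; subtracting
    1 discards (0, 0).\<close>
  have E2: "fps_nth (E * E - 1) m = (if m = 0 then 0 else fps_const (int (Suc m)))" for m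
    by (simp add: E_def fps_mult_nth fps_of_nat[symmetric])
  \<comment> \<open>The summand E collects the empty chains, by \<open>g_0\<close>; the factor t
    records the least element removed in \<open>g_Suc\<close>.\<close>
  have "G = E + t * ((E * E - 1) * G)"
  proof (intro fps_ext)
    fix n k
    have "fps_nth ((E * E - 1) * G) n
        = (\<Sum>m=0..n. (if m = 0 then 0 else fps_const (int (Suc m))) * fps_nth G (n - m))"
      by (simp only: fps_mult_nth E2)
    also have "\<dots> = (\<Sum>m=1..n. fps_const (int (Suc m)) * fps_nth G (n - m))"
      by (simp add: sum.atLeast_Suc_atMost)
    finally have "fps_nth (fps_nth (E + t * ((E * E - 1) * G)) n) k
        = fps_nth (1 + fps_X * (\<Sum>m=1..n. fps_const (int (Suc m)) * fps_nth G (n - m))) k"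
      by (simp add: E_def t_def)
    also have "\<dots> = int (g n k)"
      by (cases k) (simp_all add: g_0 g_Suc G_def fps_sum_nth algebra_simps)
    finally show "fps_nth (fps_nth G n) k = fps_nth (fps_nth (E + t * ((E * E - 1) * G)) n) k"
      by (simp add: G_def)
  qed
  \<comment> \<open>Multiplying by (1 - s)^2 eliminates E, since every occurrence then pairs with a
    factor 1 - s.\<close>
  then have "G * (1 - s)^2 = (E + t * ((E * E - 1) * G)) * (1 - s)^2"
    by (rule arg_cong)
  also have "\<dots> = (E * (1 - s)) * (1 - s) + t * (((E * (1 - s))^2 - (1 - s)^2) * G)"
    by (simp add: power2_eq_square algebra_simps)
  finally have "G * (1 - s)^2 = (1 - s) + t * ((1 - (1 - s)^2) * G)"
    by (simp add: E)
  then show ?thesis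
    by (simp add: power2_eq_square algebra_simps)
qed

end
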